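(* Let $X$ be an Archimedean vector lattice and let $n\in\mathbb N$. Every uniformly closed sublattice of $X$ of codimension $n$ contains a uniformly closed ideal of $X$ of codimension at most $2n$ in $X$.
   Context: Vector lattices are over $\mathbb R$. A sublattice is a linear subspace closed under $\vee$ and $\wedge$; an ideal is a linear subspace $J$ such that $|x|\le|y|$ and $y\in J$ imply $x\in J$. For $e\in X_+$, $I_e$ is the principal ideal generated by $e$, with the norm $\|x\|_e=\inf\{\lambda>0 : |x|\le\lambda e\}$. A net $(x_\alpha)$ in $X$ converges (relatively) uniformly to $x\in X$ if there is $e\in X_+$ with $\|x_\alpha-x\|_e\to 0$ (in particular, $x_\alpha-x\in I_e$ for all sufficiently large $\alpha$). A subset $A\subseteq X$ is uniformly closed if it is closed with respect to uniform convergence; equivalently, $A\cap I_e$ is closed in $(I_e,\|\cdot\|_e)$ for every $e\in X_+$. A subspace $F$ of $X$ has codimension $n$ if $\dim X/F=n$. *)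

theory Defs
  imports
    "HOL-Analysis.Analysis"
    "HOL-Library.Lattice_Algebras"
    "Jordan_Normal_Form.VS_Connect"
begin

section \<open>Archimedean vector lattices\<close>

class vector_lattice = ordered_real_vector + lattice_ab_group_add_abs

class archimedean_vector_lattice = vector_lattice +
  assumes archimedean: "0 \<le> x \<Longrightarrow> 0 \<le> y \<Longrightarrow> (\<And>n::nat. real n *\<^sub>R x \<le> y) \<Longrightarrow> x = 0"

definition sublattice :: "'a::vector_lattice set \<Rightarrow> bool" where
  "sublattice Y \<longleftrightarrow> real_vector.subspace Y \<and>
     (\<forall>x\<in>Y. \<forall>y\<in>Y. sup x y \<in> Y \<and> inf x y \<in> Y)"

definition order_ideal :: "'a::vector_lattice set \<Rightarrow> bool" where
  "order_ideal J \<longleftrightarrow> real_vector.subspace J \<and>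
     (\<forall>x y. \<bar>x\<bar> \<le> \<bar>y\<bar> \<and> y \<in> J \<longrightarrow> x \<in> J)"


section \<open>Uniform convergence\<close>

definition principal_ideal :: "'a::vector_lattice \<Rightarrow> 'a set" where
  "principal_ideal e = order_ideal hull {e}"

text \<open>Only meaningful on \<^term>\<open>principal_ideal e\<close>: elsewhere the infimum is over the empty set.\<close>

definition order_unit_norm :: "'a::vector_lattice \<Rightarrow> 'a \<Rightarrow> real" where
  "order_unit_norm e x = Inf {l. 0 < l \<and> \<bar>x\<bar> \<le> l *\<^sub>R e}"

text \<open>Convergence of a family along a filter; a net is the case where the filter is
  generated by the tails of a directed index set.\<close>

definition converges_uniformly :: "('i \<Rightarrow> 'a::vector_lattice) \<Rightarrow> 'a \<Rightarrow> 'i filter \<Rightarrow> bool" where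
  "converges_uniformly f x G \<longleftrightarrow>
     (\<exists>e\<ge>0. (\<forall>\<^sub>F i in G. f i - x \<in> principal_ideal e) \<and>
            ((\<lambda>i. order_unit_norm e (f i - x)) \<longlongrightarrow> 0) G)"

text \<open>A definition cannot quantify over the index types of nets. Instead of a net in \<open>A\<close> we
  use its image filter, a proper filter on the space that contains \<open>A\<close>; conversely every
  such filter comes from a net in \<open>A\<close>. The lemma after the definition recovers
  arbitrary index types.\<close>

definition uniformly_closed :: "'a::vector_lattice set \<Rightarrow> bool" where
  "uniformly_closed A \<longleftrightarrow>
     (\<forall>G x. G \<noteq> bot \<and> (\<forall>\<^sub>F a in G. a \<in> A) \<and> converges_uniformly (\<lambda>a. a) x G \<longrightarrow> x \<in> A)"

lemma uniformly_closedD: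
  assumes "uniformly_closed A" "G \<noteq> bot" "\<forall>\<^sub>F i in G. f i \<in> A" "converges_uniformly f x G"
  shows "x \<in> A"
proof -
  have "converges_uniformly (\<lambda>a. a) x (filtermap f G)"
    using assms(4) by (simp add: converges_uniformly_def eventually_filtermap filterlim_filtermap)
  then show ?thesis
    using assms(1)[unfolded uniformly_closed_def, rule_format, of "filtermap f G" x] assms(2,3)
    by (simp add: eventually_filtermap filtermap_bot_iff)
qed


section \<open>Quotient spaces and codimension\<close>

definition vcoset :: "'a::real_vector set \<Rightarrow> 'a \<Rightarrow> 'a set" where
  "vcoset F x = (+) x ` F"

text \<open>The fields \<open>mult\<close> and \<open>one\<close> of the record play no role in a module. In the scalar
  multiplication, adding \<open>F\<close> only matters for the scalar \<open>0\<close>, where the set of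
  multiples alone would be \<open>{0}\<close>.\<close>

definition quotient_space :: "'a::real_vector set \<Rightarrow> (real, 'a set) module" where
  "quotient_space F =
     \<lparr>carrier = range (vcoset F), mult = undefined, one = undefined,
      zero = F, add = (\<lambda>A B. {a + b | a b. a \<in> A \<and> b \<in> B}),
      smult = (\<lambda>c A. {c *\<^sub>R a + f | a f. a \<in> A \<and> f \<in> F})\<rparr>"

definition has_codimension :: "'a::real_vector set \<Rightarrow> nat \<Rightarrow> bool" where
  "has_codimension F n \<longleftrightarrow>
     vectorspace.fin_dim (class_ring :: real ring) (quotient_space F) \<and>
     vectorspace.dim (class_ring :: real ring) (quotient_space F) = n"

context
  fixes F :: "'a::real_vector set"
  assumes F: "real_vector.subspace F"
begin

lemma vcoset_add:
  "{a + b | a b. a \<in> vcoset F x \<and> b \<in> vcoset F y} = vcoset F (x + y)"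
proof (intro equalityI subsetI)
  fix z assume "z \<in> {a + b | a b. a \<in> vcoset F x \<and> b \<in> vcoset F y}"
  then obtain f g where "f \<in> F" "g \<in> F" "z = (x + f) + (y + g)"
    by (auto simp: vcoset_def)
  then have "z = (x + y) + (f + g)" "f + g \<in> F"
    using F by (auto simp: real_vector.subspace_add)
  then show "z \<in> vcoset F (x + y)" by (auto simp: vcoset_def)
next
  fix z assume "z \<in> vcoset F (x + y)"
  then obtain f where f: "f \<in> F" "z = (x + f) + (y + 0)"
    by (auto simp: vcoset_def)
  moreover have "0 \<in> F" using F by (rule real_vector.subspace_0)
  ultimately show "z \<in> {a + b | a b. a \<in> vcoset F x \<and> b \<in> vcoset F y}"
    unfolding vcoset_def by blast
qed

lemma vcoset_scale:
  "{c *\<^sub>R a + f | a f. a \<in> vcoset F x \<and> f \<in> F} = vcoset F (c *\<^sub>R x)"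
proof (intro equalityI subsetI)
  fix z assume "z \<in> {c *\<^sub>R a + f | a f. a \<in> vcoset F x \<and> f \<in> F}"
  then obtain f g where "f \<in> F" "g \<in> F" "z = c *\<^sub>R (x + f) + g"
    by (auto simp: vcoset_def)
  then have "z = c *\<^sub>R x + (c *\<^sub>R f + g)" "c *\<^sub>R f + g \<in> F"
    using F by (auto simp: real_vector.subspace_add real_vector.subspace_scale scaleR_add_right)
  then show "z \<in> vcoset F (c *\<^sub>R x)" by (auto simp: vcoset_def)
next
  fix z assume "z \<in> vcoset F (c *\<^sub>R x)"
  then obtain f where f: "f \<in> F" "z = c *\<^sub>R (x + 0) + f"
    by (auto simp: vcoset_def)
  moreover have "0 \<in> F" using F by (rule real_vector.subspace_0)
  ultimately show "z \<in> {c *\<^sub>R a + f | a f. a \<in> vcoset F x \<and> f \<in> F}"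
    unfolding vcoset_def by blast
qed

lemma vcoset_zero: "vcoset F 0 = F"
  by (auto simp: vcoset_def)

lemma quotient_space_simps:
  "carrier (quotient_space F) = range (vcoset F)"
  "\<zero>\<^bsub>quotient_space F\<^esub> = vcoset F 0"
  "vcoset F x \<oplus>\<^bsub>quotient_space F\<^esub> vcoset F y = vcoset F (x + y)"
  "c \<odot>\<^bsub>quotient_space F\<^esub> vcoset F x = vcoset F (c *\<^sub>R x)"
  by (simp_all add: quotient_space_def vcoset_add vcoset_scale vcoset_zero)

lemma vectorspace_quotient_space:
  "vectorspace (class_ring :: real ring) (quotient_space F)"
proof -
  have inv: "\<exists>y. vcoset F (x + y) = vcoset F 0" for x
    by (rule exI[of _ "- x"]) simp
  interpret abelian_group "quotient_space F"
    by (rule abelian_groupI) (auto simp: quotient_space_simps ac_simps inv)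
  show ?thesis
    unfolding vectorspace_def
  proof (intro conjI, rule module.intro[OF _ _ module_axioms.intro])
    show "cring (class_ring :: real ring)" by unfold_locales
    show "abelian_group (quotient_space F)" by unfold_locales
    show "field (class_ring :: real ring)" by unfold_locales
  qed (auto simp: quotient_space_simps scaleR_add_left scaleR_add_right)
qed

end

end

theory Submission
  imports Defs
begin

text \<open>
  The ideal is the largest ideal \<open>J\<close> contained in the sublattice \<open>Y\<close>, that is, the set of all
  \<open>x\<close> such that \<open>\<bar>y\<bar> \<le> \<bar>x\<bar>\<close> implies \<open>y \<in> Y\<close>. By the Riesz decomposition property it is an
  ideal, and it inherits uniform closedness from \<open>Y\<close>. Its codimension is bounded by counting
  pairwise disjoint positive vectors outside \<open>J\<close>.

  There are at most \<open>2 * n\<close> of them. Below each there is a positive vector outside \<open>Y\<close>, so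
  pairwise disjoint positive vectors \<open>w\<^sub>1, \<dots>, w\<^sub>N\<close> outside \<open>Y\<close> can be considered. In their
  span, a copy of \<open>\<real>\<^sup>N\<close>, the sublattice \<open>Y\<close> cuts out a sublattice of dimension at least
  \<open>N - n\<close>. It has a basis of positive vectors with disjoint supports, and each support has at
  least two elements because no \<open>w\<^sub>i\<close> lies in \<open>Y\<close>. Hence \<open>2 * (N - n) \<le> N\<close>, which gives
  \<open>N \<le> 2 * n\<close> (\<open>card_disjoint_family_le\<close>).

  Conversely, take such a family \<open>x\<^sub>1, \<dots>, x\<^sub>N\<close> with \<open>N\<close> as large as possible. Since \<open>J\<close> is
  uniformly closed, \<open>X / J\<close> is Archimedean. Maximality makes each \<open>x\<^sub>i\<close> an atom modulo \<open>J\<close>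
  (\<open>atom_modulo_ideal\<close>), and it forces every positive \<open>y\<close> to lie, modulo \<open>J\<close>, below a
  combination of the \<open>x\<^sub>i\<close>. Therefore \<open>J\<close> and the \<open>x\<^sub>i\<close> together span the whole space
  (\<open>span_of_maximal_disjoint_family\<close>), and \<open>J\<close> has codimension at most \<open>N \<le> 2 * n\<close>.
  The argument takes place in \<open>X\<close> itself; the quotient vector lattice is not constructed.
\<close>

section \<open>Vector lattice preliminaries\<close>

lemma abs_le_iff_lattice:
  fixes x y :: "'a::vector_lattice"
  shows "\<bar>x\<bar> \<le> y \<longleftrightarrow> x \<le> y \<and> - x \<le> y"
  by (simp add: abs_lattice)

lemma pprt_minus_pprt_uminus:
  fixes x :: "'a::vector_lattice"
  shows "pprt x - pprt (- x) = x"
  using prts[of x] by (simp add: pprt_neg)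

lemma inf_pprt_pprt_uminus:
  fixes x :: "'a::vector_lattice"
  shows "inf (pprt x) (pprt (- x)) = 0"
proof -
  have "inf (pprt x) (pprt (- x)) = inf (pprt x + 0) (pprt x + - x)"
    using pprt_minus_pprt_uminus[of x] by (simp add: algebra_simps)
  also have "\<dots> = pprt x + inf 0 (- x)"
    by (rule add_inf_distrib_left[symmetric])
  also have "inf 0 (- x) = - pprt x"
    by (simp add: pprt_def neg_sup_eq_inf inf_commute)
  finally show ?thesis by simp
qed

lemma pprt_diff_disjoint:
  fixes p q :: "'a::vector_lattice"
  assumes "inf p q = 0"
  shows "pprt (p - q) = p"
proof -
  have "pprt (p - q) = p + sup (- q) (- p)"
    by (simp add: pprt_def add_sup_distrib_left)
  also have "sup (- q) (- p) = 0"
    using assms by (metis inf_commute neg_inf_eq_sup neg_0_equal_iff_equal)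
  finally show ?thesis by simp
qed

lemma pprt_le_pprt_plus_abs:
  fixes x y :: "'a::vector_lattice"
  shows "pprt x \<le> pprt y + \<bar>x - y\<bar>"
proof -
  have "x = y + (x - y)" by simp
  also have "\<dots> \<le> pprt y + \<bar>x - y\<bar>"
    by (intro add_mono) (simp_all add: pprt_def abs_ge_self)
  finally show ?thesis
    by (simp add: pprt_def[of x] add_nonneg_nonneg)
qed

lemma abs_pprt_diff_le:
  fixes x y :: "'a::vector_lattice"
  shows "\<bar>pprt x - pprt y\<bar> \<le> \<bar>x - y\<bar>"
  using pprt_le_pprt_plus_abs[of x y] pprt_le_pprt_plus_abs[of y x]
  by (simp add: abs_le_iff_lattice algebra_simps abs_minus_commute)

lemma abs_scaleR_vector_lattice:
  fixes x :: "'a::vector_lattice"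
  shows "\<bar>c *\<^sub>R x\<bar> = \<bar>c\<bar> *\<^sub>R \<bar>x\<bar>"
proof (rule antisym)
  have le: "\<bar>c *\<^sub>R x\<bar> \<le> \<bar>c\<bar> *\<^sub>R \<bar>x\<bar>" for c :: real and x :: 'a
  proof (cases "0 \<le> c")
    case True
    then show ?thesis
      using scaleR_left_mono[of x "\<bar>x\<bar>" c] scaleR_left_mono[of "- x" "\<bar>x\<bar>" c]
      by (simp add: abs_le_iff_lattice abs_ge_self abs_ge_minus_self)
  next
    case False
    then show ?thesis
      using scaleR_left_mono[of x "\<bar>x\<bar>" "- c"] scaleR_left_mono[of "- x" "\<bar>x\<bar>" "- c"]
      by (simp add: abs_le_iff_lattice abs_ge_self abs_ge_minus_self)
  qed
  show "\<bar>c *\<^sub>R x\<bar> \<le> \<bar>c\<bar> *\<^sub>R \<bar>x\<bar>" by (rule le)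
  show "\<bar>c\<bar> *\<^sub>R \<bar>x\<bar> \<le> \<bar>c *\<^sub>R x\<bar>"
  proof (cases "c = 0")
    case False
    then have "\<bar>c\<bar> *\<^sub>R \<bar>x\<bar> \<le> \<bar>c\<bar> *\<^sub>R (\<bar>1 / c\<bar> *\<^sub>R \<bar>c *\<^sub>R x\<bar>)"
      using le[of "1 / c" "c *\<^sub>R x"] by (intro scaleR_left_mono) simp_all
    then show ?thesis using False by simp
  qed simp
qed

text \<open>The Riesz decomposition property; the first summand is the truncation of \<open>y\<close> to
  the order interval from \<open>- u\<close> to \<open>u\<close>.\<close>

lemma riesz_decomposition:
  fixes y u v :: "'a::vector_lattice"
  assumes "\<bar>y\<bar> \<le> u + v" "0 \<le> u" "0 \<le> v"
  obtains y1 y2 where "y = y1 + y2" "\<bar>y1\<bar> \<le> u" "\<bar>y2\<bar> \<le> v"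
proof
  let ?t = "sup (- u) (inf y u)"
  show "y = ?t + (y - ?t)" by (metis add.commute diff_add_cancel)
  have "- u \<le> u" using assms(2) by (simp add: minus_le_self_iff)
  then show "\<bar>?t\<bar> \<le> u"
    unfolding abs_le_iff_lattice by (simp add: minus_le_iff)
  have y: "y \<le> u + v" "- y \<le> u + v"
    using assms(1) by (simp_all add: abs_le_iff_lattice)
  have eq: "y - ?t = inf (y + u) (sup 0 (y - u))"
    by (simp add: diff_sup_eq_inf add_inf_distrib_left add_sup_distrib_left neg_inf_eq_sup)
  have "y - ?t \<le> sup 0 (y - u)"
    unfolding eq by simp
  also have "\<dots> \<le> v"
    using assms(3) y(1) by (simp add: algebra_simps)
  finally have 1: "y - ?t \<le> v" .
  have "- v \<le> y + u"
    using add_left_mono[OF y(2), of "y - v"] by (simp add: algebra_simps)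
  moreover have "- v \<le> sup 0 (y - u)"
    using assms(3) by (simp add: le_supI1)
  ultimately have "- v \<le> y - ?t"
    unfolding eq by simp
  then have "- (y - ?t) \<le> v"
    by (metis minus_le_iff)
  with 1 show "\<bar>y - ?t\<bar> \<le> v"
    unfolding abs_le_iff_lattice by simp
qed

lemma disjoint_mono:
  fixes u v a b :: "'a::vector_lattice"
  assumes "inf a b = 0" "0 \<le> u" "u \<le> a" "0 \<le> v" "v \<le> b"
  shows "inf u v = 0"
proof (rule antisym)
  show "inf u v \<le> 0"
    using inf_mono[OF assms(3,5)] assms(1) by simp
qed (use assms in simp)

lemma disjoint_add:
  fixes a b c :: "'a::vector_lattice"
  assumes "inf a c = 0" "inf b c = 0"
  shows "inf (a + b) c = 0"
proof (rule antisym)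
  have pos: "0 \<le> a" "0 \<le> b" "0 \<le> c"
    using assms by (metis inf_le1, metis inf_le1, metis inf_le2)
  show "0 \<le> inf (a + b) c"
    using pos by simp
  let ?d = "inf (a + b) c"
  have "?d - b \<le> a"
    using inf_le1[of "a + b" c] by (simp only: diff_le_eq)
  moreover have "?d - b \<le> c"
    using inf_le2[of "a + b" c] pos(2) by (metis add.right_neutral diff_le_eq add_mono)
  ultimately have "?d - b \<le> inf a c" by simp
  then have "?d \<le> b" using assms(1) by simp
  then have "?d \<le> inf b c" by simp
  then show "?d \<le> 0" using assms(2) by simp
qed

lemma disjoint_scaleR:
  fixes a b :: "'a::vector_lattice"
  assumes "inf a b = 0" "0 \<le> s"
  shows "inf (s *\<^sub>R a) b = 0"
proof (rule antisym)
  have pos: "0 \<le> a" "0 \<le> b"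
    using assms(1) by (metis inf_le1, metis inf_le2)
  show "0 \<le> inf (s *\<^sub>R a) b"
    using pos assms(2) by (simp add: scaleR_nonneg_nonneg)
  define k where "k = max 1 s"
  have k: "1 \<le> k" "s \<le> k" by (auto simp: k_def)
  let ?m = "inf (s *\<^sub>R a) b"
  have "?m \<le> s *\<^sub>R a" by simp
  also have "\<dots> \<le> k *\<^sub>R a" using k(2) pos(1) by (rule scaleR_right_mono)
  finally have "(1 / k) *\<^sub>R ?m \<le> (1 / k) *\<^sub>R (k *\<^sub>R a)"
    using k by (intro scaleR_left_mono) auto
  then have 1: "(1 / k) *\<^sub>R ?m \<le> a" using k by simp
  have "?m \<le> b" by simp
  also have "b \<le> k *\<^sub>R b" using scaleR_right_mono[OF k(1) pos(2)] by simp
  finally have "(1 / k) *\<^sub>R ?m \<le> (1 / k) *\<^sub>R (k *\<^sub>R b)"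
    using k by (intro scaleR_left_mono) auto
  then have "(1 / k) *\<^sub>R ?m \<le> b" using k by simp
  with 1 have "(1 / k) *\<^sub>R ?m \<le> 0"
    using assms(1) by (metis le_inf_iff)
  then have "k *\<^sub>R ((1 / k) *\<^sub>R ?m) \<le> k *\<^sub>R 0"
    using k by (intro scaleR_left_mono) auto
  then show "?m \<le> 0" using k by simp
qed

lemma disjoint_sum:
  fixes f :: "'i \<Rightarrow> 'a::vector_lattice"
  assumes "finite I" "\<And>i. i \<in> I \<Longrightarrow> inf (f i) c = 0" "0 \<le> c"
  shows "inf (sum f I) c = 0"
  using assms(1,2)
proof (induction I)
  case empty
  then show ?case using assms(3) by (simp add: inf_absorb1)
next
  case (insert i I)
  then show ?case by (simp add: disjoint_add)
qed

lemma pprt_sum_disjoint: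
  fixes w :: "'i \<Rightarrow> 'a::vector_lattice"
  assumes "finite I" "\<And>i. i \<in> I \<Longrightarrow> 0 \<le> w i"
    and disj: "\<And>i j. i \<in> I \<Longrightarrow> j \<in> I \<Longrightarrow> i \<noteq> j \<Longrightarrow> inf (w i) (w j) = 0"
  shows "pprt (\<Sum>i\<in>I. c i *\<^sub>R w i) = (\<Sum>i\<in>I. max (c i) 0 *\<^sub>R w i)"
proof -
  let ?p = "\<Sum>i\<in>I. max (c i) 0 *\<^sub>R w i" and ?q = "\<Sum>i\<in>I. max (- c i) 0 *\<^sub>R w i"
  have pos: "0 \<le> max s 0 *\<^sub>R w i" if "i \<in> I" for s i
    using assms(2)[OF that] by (simp add: scaleR_nonneg_nonneg)
  have *: "inf (max (c i) 0 *\<^sub>R w i) (max (- c j) 0 *\<^sub>R w j) = 0" if "i \<in> I" "j \<in> I" for i j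
  proof (cases "i = j")
    case True
    show ?thesis
    proof (cases "0 \<le> c i")
      case True
      then show ?thesis using pos[OF that(1), of "c i"] \<open>i = j\<close> by (simp add: inf_absorb2)
    next
      case False
      then show ?thesis using pos[OF that(2), of "- c j"] \<open>i = j\<close> by (simp add: inf_absorb1)
    qed
  next
    case False
    have "inf (max (- c j) 0 *\<^sub>R w j) (max (c i) 0 *\<^sub>R w i) = 0"
      by (intro disjoint_scaleR) (use disjoint_scaleR[OF disj[OF that False]] in
          \<open>simp_all add: inf_commute\<close>)
    then show ?thesis by (simp add: inf_commute)
  qed
  have "inf ?p ?q = 0"
  proof (rule disjoint_sum[OF assms(1)])
    show "inf (max (c i) 0 *\<^sub>R w i) ?q = 0" if "i \<in> I" for i
    proof -
      have "inf ?q (max (c i) 0 *\<^sub>R w i) = 0"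
        by (rule disjoint_sum[OF assms(1)]) (use * that pos in \<open>simp_all add: inf_commute\<close>)
      then show ?thesis by (simp add: inf_commute)
    qed
  qed (use pos in \<open>simp add: sum_nonneg\<close>)
  then have "pprt (?p - ?q) = ?p" by (rule pprt_diff_disjoint)
  also have "?p - ?q = (\<Sum>i\<in>I. c i *\<^sub>R w i)"
    unfolding sum_subtractf[symmetric] scaleR_diff_left[symmetric]
    by (intro sum.cong arg_cong2[where f = scaleR]) auto
  finally show ?thesis .
qed


section \<open>Ideals and uniformly closed sets\<close>

lemma order_ideal_subspace: "order_ideal J \<Longrightarrow> real_vector.subspace J"
  by (simp add: order_ideal_def)

lemma order_ideal_mono: "order_ideal J \<Longrightarrow> y \<in> J \<Longrightarrow> \<bar>x\<bar> \<le> \<bar>y\<bar> \<Longrightarrow> x \<in> J"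
  unfolding order_ideal_def by blast

lemma order_ideal_mono_nonneg:
  assumes "order_ideal J" "y \<in> J" "0 \<le> x" "x \<le> y"
  shows "x \<in> J"
  by (rule order_ideal_mono[OF assms(1,2)])
    (use assms in \<open>simp add: abs_of_nonneg order_trans[OF assms(3,4)]\<close>)

lemma principal_ideal_eq:
  fixes e :: "'a::vector_lattice"
  assumes "0 \<le> e"
  shows "principal_ideal e = {x. \<exists>l>0. \<bar>x\<bar> \<le> l *\<^sub>R e}" (is "_ = ?I")
proof
  have "order_ideal ?I"
    unfolding order_ideal_def
  proof (intro conjI allI impI real_vector.subspaceI)
    show "0 \<in> ?I" using assms by (auto intro!: exI[of _ 1])
    show "x + y \<in> ?I" if xy: "x \<in> ?I" "y \<in> ?I" for x y
    proof -
      obtain l k where lk: "l > 0" "\<bar>x\<bar> \<le> l *\<^sub>R e" "k > 0" "\<bar>y\<bar> \<le> k *\<^sub>R e"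
        using xy by auto
      have "\<bar>x + y\<bar> \<le> (l + k) *\<^sub>R e"
        unfolding scaleR_add_left by (rule order_trans[OF abs_triangle_ineq add_mono[OF lk(2,4)]])
      then show ?thesis using lk by (auto intro!: exI[of _ "l + k"])
    qed
    show "c *\<^sub>R x \<in> ?I" if x: "x \<in> ?I" for c x
    proof -
      obtain l where l: "l > 0" "\<bar>x\<bar> \<le> l *\<^sub>R e" using x by auto
      have "\<bar>c *\<^sub>R x\<bar> = \<bar>c\<bar> *\<^sub>R \<bar>x\<bar>" by (rule abs_scaleR_vector_lattice)
      also have "\<dots> \<le> \<bar>c\<bar> *\<^sub>R (l *\<^sub>R e)"
        using l by (intro scaleR_left_mono) auto
      also have "\<dots> \<le> (\<bar>c\<bar> * l + 1) *\<^sub>R e"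
        using assms by (simp add: scaleR_add_left)
      finally have "\<bar>c *\<^sub>R x\<bar> \<le> (\<bar>c\<bar> * l + 1) *\<^sub>R e" .
      moreover have "\<bar>c\<bar> * l + 1 > 0" using l by (simp add: add_nonneg_pos)
      ultimately show ?thesis by blast
    qed
  next
    fix x y assume "\<bar>x\<bar> \<le> \<bar>y\<bar> \<and> y \<in> ?I"
    then show "x \<in> ?I" by (auto intro: order_trans)
  qed
  moreover have "e \<in> ?I" using assms by (auto intro!: exI[of _ 1])
  ultimately show "principal_ideal e \<subseteq> ?I"
    unfolding principal_ideal_def by (intro hull_minimal) auto
  show "?I \<subseteq> principal_ideal e"
    unfolding principal_ideal_def hull_def
  proof clarify
    fix x l J
    assume "(0::real) < l" "\<bar>x\<bar> \<le> l *\<^sub>R e" "order_ideal J" "{e} \<subseteq> J"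
    moreover from this have "l *\<^sub>R e \<in> J"
      by (intro real_vector.subspace_scale order_ideal_subspace) auto
    moreover have "\<bar>l *\<^sub>R e\<bar> = l *\<^sub>R e"
      using assms \<open>0 < l\<close> by (simp add: abs_of_nonneg scaleR_nonneg_nonneg)
    ultimately show "x \<in> J" by (intro order_ideal_mono[of J "l *\<^sub>R e" x]) simp_all
  qed
qed

text \<open>Nets and filters can be avoided: a set is uniformly closed iff it contains every point
  that it approximates with arbitrarily small multiples of a fixed regulator \<open>e\<close>.\<close>

lemma uniformly_closed_iff:
  fixes A :: "'a::vector_lattice set"
  shows "uniformly_closed A \<longleftrightarrow>
    (\<forall>e\<ge>0. \<forall>x. (\<forall>\<epsilon>>0. \<exists>a\<in>A. \<bar>a - x\<bar> \<le> \<epsilon> *\<^sub>R e) \<longrightarrow> x \<in> A)" (is "?L \<longleftrightarrow> ?R")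
proof
  assume ?L
  show ?R
  proof (intro allI impI)
    fix e x :: 'a assume e: "0 \<le> e" and approx: "\<forall>\<epsilon>>0. \<exists>a\<in>A. \<bar>a - x\<bar> \<le> \<epsilon> *\<^sub>R e"
    have "\<forall>n. \<exists>a\<in>A. \<bar>a - x\<bar> \<le> (1 / real (Suc n)) *\<^sub>R e"
      using approx by simp
    then obtain f where f: "f n \<in> A" "\<bar>f n - x\<bar> \<le> (1 / real (Suc n)) *\<^sub>R e" for n
      by metis
    have bdd: "bdd_below {l. 0 < l \<and> \<bar>f n - x\<bar> \<le> l *\<^sub>R e}" for n
      by (rule bdd_belowI[of _ 0]) simp
    have up: "order_unit_norm e (f n - x) \<le> 1 / real (Suc n)" for n
      unfolding order_unit_norm_def by (rule cInf_lower[OF _ bdd]) (use f in simp)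
    have lo: "0 \<le> order_unit_norm e (f n - x)" for n
      unfolding order_unit_norm_def
      by (rule cInf_greatest) (use f(2)[of n] in \<open>auto intro!: exI[of _ "1 / real (Suc n)"]\<close>)
    have "(\<lambda>n. order_unit_norm e (f n - x)) \<longlonglongrightarrow> 0"
      by (rule tendsto_sandwich[OF always_eventually always_eventually tendsto_const
            LIMSEQ_Suc[OF lim_1_over_n]]) (use up lo in auto)
    moreover have "f n - x \<in> principal_ideal e" for n
      unfolding principal_ideal_eq[OF e] using f(2)[of n]
      by (auto intro!: exI[of _ "1 / real (Suc n)"])
    ultimately have "converges_uniformly f x sequentially"
      unfolding converges_uniformly_def using e by auto
    then show "x \<in> A"
      by (intro uniformly_closedD[OF \<open>?L\<close>, of sequentially f]) (use f in auto)
  qed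
next
  assume R: ?R
  show ?L
    unfolding uniformly_closed_def
  proof (intro allI impI, elim conjE)
    fix G :: "'a filter" and x
    assume G: "G \<noteq> bot" "\<forall>\<^sub>F a in G. a \<in> A" "converges_uniformly (\<lambda>a. a) x G"
    obtain e where e: "0 \<le> e" "\<forall>\<^sub>F a in G. a - x \<in> principal_ideal e"
      "((\<lambda>a. order_unit_norm e (a - x)) \<longlongrightarrow> 0) G"
      using G(3) unfolding converges_uniformly_def by auto
    have "\<exists>a\<in>A. \<bar>a - x\<bar> \<le> \<epsilon> *\<^sub>R e" if "\<epsilon> > 0" for \<epsilon>
    proof -
      have "\<forall>\<^sub>F a in G. order_unit_norm e (a - x) < \<epsilon>"
        using e(3) that by (rule order_tendstoD)
      with G(2) e(2) have "\<forall>\<^sub>F a in G. a \<in> A \<and> a - x \<in> principal_ideal e \<and> order_unit_norm e (a - x) < \<epsilon>"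
        by eventually_elim simp
      then obtain a where a: "a \<in> A" "a - x \<in> principal_ideal e" "order_unit_norm e (a - x) < \<epsilon>"
        using G(1) eventually_happens' by blast
      have "{l. 0 < l \<and> \<bar>a - x\<bar> \<le> l *\<^sub>R e} \<noteq> {}"
        using a(2) unfolding principal_ideal_eq[OF e(1)] by auto
      from cInf_lessD[OF this a(3)[unfolded order_unit_norm_def]]
      obtain l where l: "\<bar>a - x\<bar> \<le> l *\<^sub>R e" "l < \<epsilon>" by auto
      note l(1)
      also have "l *\<^sub>R e \<le> \<epsilon> *\<^sub>R e"
        using l(2) e(1) by (intro scaleR_right_mono) auto
      finally show ?thesis using a(1) by blast
    qed
    then show "x \<in> A" using R e(1) by blast
  qed
qed

lemma uniformly_closedD_approx:
  fixes A :: "'a::vector_lattice set"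
  assumes "uniformly_closed A" "0 \<le> e" "\<And>\<epsilon>. \<epsilon> > 0 \<Longrightarrow> \<exists>a\<in>A. \<bar>a - x\<bar> \<le> \<epsilon> *\<^sub>R e"
  shows "x \<in> A"
  using assms unfolding uniformly_closed_iff by blast

text \<open>The largest solid subset of \<open>A\<close>. If \<open>A\<close> is a subspace, this is the largest
  ideal contained in \<open>A\<close>.\<close>

definition solid_core :: "'a::vector_lattice set \<Rightarrow> 'a set" where
  "solid_core A = {x. \<forall>y. \<bar>y\<bar> \<le> \<bar>x\<bar> \<longrightarrow> y \<in> A}"

lemma solid_core_subset: "solid_core A \<subseteq> A"
  by (auto simp: solid_core_def)

lemma order_ideal_subset_solid_core:
  assumes "order_ideal J" "J \<subseteq> A"
  shows "J \<subseteq> solid_core A"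
  unfolding solid_core_def using order_ideal_mono[OF assms(1)] assms(2) by blast

lemma order_ideal_solid_core:
  fixes A :: "'a::vector_lattice set"
  assumes A: "real_vector.subspace A"
  shows "order_ideal (solid_core A)"
proof -
  have add: "x1 + x2 \<in> solid_core A" if x: "x1 \<in> solid_core A" "x2 \<in> solid_core A" for x1 x2
    unfolding solid_core_def
  proof clarify
    fix y assume "\<bar>y\<bar> \<le> \<bar>x1 + x2\<bar>"
    then have "\<bar>y\<bar> \<le> \<bar>x1\<bar> + \<bar>x2\<bar>" by (rule order_trans) (rule abs_triangle_ineq)
    then obtain y1 y2 where "y = y1 + y2" "\<bar>y1\<bar> \<le> \<bar>x1\<bar>" "\<bar>y2\<bar> \<le> \<bar>x2\<bar>"
      by (rule riesz_decomposition) auto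
    then show "y \<in> A"
      using x A by (auto simp: solid_core_def real_vector.subspace_add)
  qed
  have scale: "c *\<^sub>R x \<in> solid_core A" if x: "x \<in> solid_core A" for c x
    unfolding solid_core_def
  proof clarify
    fix y assume y: "\<bar>y\<bar> \<le> \<bar>c *\<^sub>R x\<bar>"
    show "y \<in> A"
    proof (cases "c = 0")
      case True
      then show ?thesis using y real_vector.subspace_0[OF A] by simp
    next
      case False
      have "\<bar>(1 / c) *\<^sub>R y\<bar> \<le> \<bar>1 / c\<bar> *\<^sub>R (\<bar>c\<bar> *\<^sub>R \<bar>x\<bar>)"
        unfolding abs_scaleR_vector_lattice
        using y by (intro scaleR_left_mono) (simp_all add: abs_scaleR_vector_lattice)
      then have "\<bar>(1 / c) *\<^sub>R y\<bar> \<le> \<bar>x\<bar>" using False by simp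
      then have "(1 / c) *\<^sub>R y \<in> A" using x by (simp add: solid_core_def)
      then have "c *\<^sub>R ((1 / c) *\<^sub>R y) \<in> A" by (rule real_vector.subspace_scale[OF A])
      then show ?thesis using False by simp
    qed
  qed
  show ?thesis
    unfolding order_ideal_def
  proof (intro conjI allI impI real_vector.subspaceI add scale)
    show "0 \<in> solid_core A"
      using real_vector.subspace_0[OF A] by (auto simp: solid_core_def)
    fix x y :: 'a assume "\<bar>x\<bar> \<le> \<bar>y\<bar> \<and> y \<in> solid_core A"
    then show "x \<in> solid_core A" by (auto simp: solid_core_def intro: order_trans)
  qed
qed

text \<open>If \<open>a\<close> is in the core and approximates \<open>x\<close>, then truncating \<open>y\<close> at \<open>\<bar>a\<bar>\<close> gives an element
  of \<open>A\<close> at least as close to \<open>y\<close> as \<open>a\<close> is to \<open>x\<close>.\<close>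

lemma uniformly_closed_solid_core:
  fixes A :: "'a::vector_lattice set"
  assumes A: "uniformly_closed A"
  shows "uniformly_closed (solid_core A)"
  unfolding uniformly_closed_iff
proof (intro allI impI)
  fix e x :: 'a
  assume e: "0 \<le> e" and approx: "\<forall>\<epsilon>>0. \<exists>a\<in>solid_core A. \<bar>a - x\<bar> \<le> \<epsilon> *\<^sub>R e"
  show "x \<in> solid_core A"
    unfolding solid_core_def
  proof clarify
    fix y assume y: "\<bar>y\<bar> \<le> \<bar>x\<bar>"
    show "y \<in> A"
    proof (rule uniformly_closedD_approx[OF A e])
      fix \<epsilon> :: real assume "\<epsilon> > 0"
      then obtain a where a: "a \<in> solid_core A" "\<bar>a - x\<bar> \<le> \<epsilon> *\<^sub>R e" using approx by blast
      have "\<bar>x\<bar> \<le> \<bar>a\<bar> + \<bar>a - x\<bar>"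
        using abs_triangle_ineq[of a "x - a"] by (simp add: abs_minus_commute)
      with y have "\<bar>y\<bar> \<le> \<bar>a\<bar> + \<bar>a - x\<bar>" by (rule order_trans)
      then obtain y1 y2 where y12: "y = y1 + y2" "\<bar>y1\<bar> \<le> \<bar>a\<bar>" "\<bar>y2\<bar> \<le> \<bar>a - x\<bar>"
        by (rule riesz_decomposition) auto
      have "y1 \<in> A" using a(1) y12(2) by (simp add: solid_core_def)
      moreover have "\<bar>y1 - y\<bar> \<le> \<epsilon> *\<^sub>R e"
        using order_trans[OF y12(3) a(2)] y12(1) by simp
      ultimately show "\<exists>a\<in>A. \<bar>a - y\<bar> \<le> \<epsilon> *\<^sub>R e" by blast
    qed
  qed
qed


section \<open>Codimension\<close>

lemma vcoset_eq_iff: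
  assumes F: "real_vector.subspace F"
  shows "vcoset F x = vcoset F y \<longleftrightarrow> x - y \<in> F"
proof
  assume "vcoset F x = vcoset F y"
  moreover have "x \<in> vcoset F x"
    using real_vector.subspace_0[OF F] by (auto simp: vcoset_def intro!: image_eqI[of _ _ 0])
  ultimately show "x - y \<in> F" by (auto simp: vcoset_def)
next
  have sub: "vcoset F x \<subseteq> vcoset F y" if "x - y \<in> F" for x y
  proof
    fix z assume "z \<in> vcoset F x"
    then obtain f where f: "f \<in> F" "z = y + ((x - y) + f)" by (auto simp: vcoset_def)
    show "z \<in> vcoset F y"
      unfolding vcoset_def f(2) by (intro imageI real_vector.subspace_add[OF F that] f(1))
  qed
  assume "x - y \<in> F"
  moreover from this have "y - x \<in> F"
    using real_vector.subspace_neg[OF F] by force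
  ultimately show "vcoset F x = vcoset F y" using sub by blast
qed

lemma finsum_vcoset:
  assumes F: "real_vector.subspace F" and "finite I"
  shows "finsum (quotient_space F) (\<lambda>i. vcoset F (g i)) I = vcoset F (sum g I)"
proof -
  interpret vectorspace "class_ring :: real ring" "quotient_space F"
    by (rule vectorspace_quotient_space[OF F])
  show ?thesis
    using \<open>finite I\<close>
  proof (induction I)
    case empty
    then show ?case by (simp add: quotient_space_simps[OF F])
  next
    case (insert i I)
    have c: "vcoset F x \<in> carrier (quotient_space F)" for x
      by (simp add: quotient_space_simps[OF F])
    from insert show ?case
      by (simp add: M.finsum_insert c Pi_def quotient_space_simps(3)[OF F])
  qed
qed

lemma codimension_le_card:
  assumes F: "real_vector.subspace F" and I: "finite I"
    and span: "\<And>y. \<exists>c. y - (\<Sum>i\<in>I. c i *\<^sub>R x i) \<in> F"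
  shows "\<exists>m\<le>card I. has_codimension F m"
proof -
  interpret vectorspace "class_ring :: real ring" "quotient_space F"
    by (rule vectorspace_quotient_space[OF F])
  let ?B = "(\<lambda>i. vcoset F (x i)) ` I"
  have B: "finite ?B" "?B \<subseteq> carrier (quotient_space F)"
    using I by (auto simp: quotient_space_simps[OF F])
  interpret S: submodule "class_ring :: real ring" "span ?B" "quotient_space F"
    by (rule span_is_submodule[OF B(2)])
  have sum: "vcoset F (\<Sum>i\<in>K. c i *\<^sub>R x i) \<in> span ?B" if "finite K" "K \<subseteq> I" for K c
    using that
  proof (induction K)
    case empty
    then show ?case using S.zero_closed by (simp add: quotient_space_simps[OF F])
  next
    case (insert i K)
    then have "vcoset F (x i) \<in> span ?B" using in_own_span[OF B(2)] by auto
    then have "c i \<odot>\<^bsub>quotient_space F\<^esub> vcoset F (x i) \<in> span ?B"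
      by (intro S.smult_closed) auto
    then have "vcoset F (c i *\<^sub>R x i) \<in> span ?B"
      by (simp add: quotient_space_simps[OF F])
    moreover have "vcoset F (\<Sum>i\<in>K. c i *\<^sub>R x i) \<in> span ?B" using insert by auto
    ultimately have "vcoset F (c i *\<^sub>R x i) \<oplus>\<^bsub>quotient_space F\<^esub> vcoset F (\<Sum>i\<in>K. c i *\<^sub>R x i) \<in> span ?B"
      by (rule S.m_closed)
    then show ?case using insert by (simp add: quotient_space_simps[OF F])
  qed
  have "carrier (quotient_space F) \<subseteq> span ?B"
  proof
    fix z assume "z \<in> carrier (quotient_space F)"
    then obtain y where "z = vcoset F y" by (auto simp: quotient_space_simps[OF F])
    moreover obtain c where "y - (\<Sum>i\<in>I. c i *\<^sub>R x i) \<in> F" using span by blast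
    ultimately have "z = vcoset F (\<Sum>i\<in>I. c i *\<^sub>R x i)" by (simp add: vcoset_eq_iff[OF F])
    then show "z \<in> span ?B" using sum[OF I subset_refl] by simp
  qed
  then have gen: "gen_set ?B" using S.subset by blast
  then have "fin_dim" unfolding fin_dim_def using B by blast
  moreover have "dim \<le> card ?B" by (rule gen_ge_dim[OF B gen])
  moreover have "card ?B \<le> card I" by (rule card_image_le[OF I])
  ultimately show ?thesis unfolding has_codimension_def using order_trans by blast
qed

lemma card_le_codimension:
  assumes F: "real_vector.subspace F" and codim: "has_codimension F n" and I: "finite I"
    and indep: "\<And>c. (\<Sum>i\<in>I. c i *\<^sub>R w i) \<in> F \<Longrightarrow> \<forall>i\<in>I. c i = 0"
  shows "card I \<le> n"
proof -
  interpret vectorspace "class_ring :: real ring" "quotient_space F"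
    by (rule vectorspace_quotient_space[OF F])
  let ?w = "\<lambda>i. vcoset F (w i)"
  have fin: "fin_dim" and dim: "dim = n" using codim by (simp_all add: has_codimension_def)
  have inj: "inj_on ?w I"
  proof (rule inj_onI, rule ccontr)
    fix i j assume ij: "i \<in> I" "j \<in> I" "?w i = ?w j" "i \<noteq> j"
    let ?c = "\<lambda>k. (if k = i then 1 else 0) - (if k = j then 1 else (0::real))"
    have "(\<Sum>k\<in>I. ?c k *\<^sub>R w k) = w i - w j"
      using I ij by (simp add: scaleR_diff_left sum_subtractf if_distrib[of "\<lambda>r. r *\<^sub>R _"] cong: if_cong)
    also have "\<dots> \<in> F" using ij(3) by (simp add: vcoset_eq_iff[OF F])
    finally have "?c i = 0" using indep[of ?c] ij(1) by blast
    then show False using ij(4) by simp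
  qed
  have c: "?w ` I \<subseteq> carrier (quotient_space F)" by (auto simp: quotient_space_simps[OF F])
  have "lin_indpt (?w ` I)"
  proof (rule finite_lin_indpt2)
    fix a assume "lincomb a (?w ` I) = \<zero>\<^bsub>quotient_space F\<^esub>"
    moreover have "lincomb a (?w ` I) = finsum (quotient_space F) (\<lambda>i. vcoset F (a (?w i) *\<^sub>R w i)) I"
      unfolding lincomb_def
      by (subst M.finsum_reindex[OF _ inj]) (auto simp: quotient_space_simps[OF F] Pi_def)
    ultimately have "vcoset F (\<Sum>i\<in>I. a (?w i) *\<^sub>R w i) = vcoset F 0"
      by (simp add: finsum_vcoset[OF F I] quotient_space_simps[OF F])
    then have "(\<Sum>i\<in>I. a (?w i) *\<^sub>R w i) \<in> F"
      by (simp only: vcoset_eq_iff[OF F] diff_zero)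
    from indep[OF this] show "\<forall>v\<in>?w ` I. a v = \<zero>\<^bsub>class_ring\<^esub>" by simp
  qed (use I c in auto)
  from li_le_dim(2)[OF fin c this] show ?thesis
    by (simp add: card_image[OF inj] dim)
qed


section \<open>Disjoint families\<close>

text \<open>Pairwise disjoint positive vectors outside a sublattice of codimension \<open>n\<close>: choose a
  maximal subfamily \<open>A\<close> that is linearly independent modulo \<open>Y\<close>. Every other member \<open>w j\<close>
  becomes an element \<open>v j\<close> of \<open>Y\<close> after adding a nonnegative, nonzero combination of \<open>A\<close>.
  The supports of these combinations are disjoint for different \<open>j\<close>, so there are at most as
  many \<open>j\<close> outside \<open>A\<close> as there are elements of \<open>A\<close>.\<close>

lemma card_disjoint_family_le:
  fixes Y :: "'a::vector_lattice set" and w :: "'i \<Rightarrow> 'a"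
  assumes Y: "sublattice Y" and codim: "has_codimension Y n" and I: "finite I"
    and w: "\<And>i. i \<in> I \<Longrightarrow> 0 \<le> w i" "\<And>i. i \<in> I \<Longrightarrow> w i \<notin> Y"
    and disj: "\<And>i j. i \<in> I \<Longrightarrow> j \<in> I \<Longrightarrow> i \<noteq> j \<Longrightarrow> inf (w i) (w j) = 0"
  shows "card I \<le> 2 * n"
proof -
  have sub: "real_vector.subspace Y" using Y by (simp add: sublattice_def)
  have pprt: "pprt y \<in> Y" if "y \<in> Y" for y
    using Y that real_vector.subspace_0[OF sub] by (simp add: sublattice_def pprt_def)
  define ind where "ind A \<longleftrightarrow> (\<forall>c. (\<Sum>i\<in>A. c i *\<^sub>R w i) \<in> Y \<longrightarrow> (\<forall>i\<in>A. c i = 0))" for A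
  have "\<exists>A\<in>{A. A \<subseteq> I \<and> ind A}. \<forall>B\<in>{A. A \<subseteq> I \<and> ind A}. A \<subseteq> B \<longrightarrow> A = B"
  proof (rule finite_has_maximal)
    have "{} \<in> {A. A \<subseteq> I \<and> ind A}" by (simp add: ind_def)
    then show "{A. A \<subseteq> I \<and> ind A} \<noteq> {}" by blast
  qed (use I in simp)
  then obtain A where A: "A \<subseteq> I" "ind A"
    and maximal: "\<And>B. B \<subseteq> I \<Longrightarrow> ind B \<Longrightarrow> A \<subseteq> B \<Longrightarrow> A = B"
    by auto
  have finA: "finite A" using A(1) I by (rule finite_subset)
  have indD: "c i = 0" if "(\<Sum>i\<in>A. c i *\<^sub>R w i) \<in> Y" "i \<in> A" for c i
    using A(2) that unfolding ind_def by blast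
  have pprt_sum: "pprt (\<Sum>i\<in>B. c i *\<^sub>R w i) = (\<Sum>i\<in>B. max (c i) 0 *\<^sub>R w i)"
    if "B \<subseteq> I" for B c
    by (rule pprt_sum_disjoint[OF finite_subset[OF that I]]) (use that w(1) disj in blast)+
  have "\<exists>d. (\<forall>a\<in>A. 0 \<le> d a) \<and> w j + (\<Sum>a\<in>A. d a *\<^sub>R w a) \<in> Y" if j: "j \<in> I - A" for j
  proof -
    \<comment> \<open>Maximality gives a combination in \<open>Y\<close>; normalise the coefficient of \<open>w j\<close> to \<open>1\<close> and take
      the positive part, which drops the negative coefficients.\<close>
    have "\<not> ind (insert j A)" using maximal[of "insert j A"] A(1) j by blast
    then obtain c where c: "(\<Sum>i\<in>insert j A. c i *\<^sub>R w i) \<in> Y" "\<exists>i\<in>insert j A. c i \<noteq> 0"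
      unfolding ind_def by blast
    have "c j \<noteq> 0"
    proof
      assume "c j = 0"
      then show False using c j finA indD[of c] by auto
    qed
    define b where "b i = c i / c j" for i
    have "(\<Sum>i\<in>insert j A. b i *\<^sub>R w i) = (1 / c j) *\<^sub>R (\<Sum>i\<in>insert j A. c i *\<^sub>R w i)"
      by (simp add: b_def scaleR_sum_right divide_inverse mult.commute)
    also have "\<dots> \<in> Y" by (rule real_vector.subspace_scale[OF sub c(1)])
    finally have "pprt (\<Sum>i\<in>insert j A. b i *\<^sub>R w i) \<in> Y" by (rule pprt)
    then have "(\<Sum>i\<in>insert j A. max (b i) 0 *\<^sub>R w i) \<in> Y"
      using pprt_sum[of "insert j A" b] A(1) j by simp
    then have "w j + (\<Sum>a\<in>A. max (b a) 0 *\<^sub>R w a) \<in> Y"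
      using finA j \<open>c j \<noteq> 0\<close> by (simp add: b_def)
    then show ?thesis by (intro exI[of _ "\<lambda>a. max (b a) 0"]) simp
  qed
  then obtain d where d: "\<And>j a. j \<in> I - A \<Longrightarrow> a \<in> A \<Longrightarrow> 0 \<le> d j a"
    "\<And>j. j \<in> I - A \<Longrightarrow> w j + (\<Sum>a\<in>A. d j a *\<^sub>R w a) \<in> Y"
    by metis
  have "\<exists>a\<in>A. d j a \<noteq> 0" if "j \<in> I - A" for j
  proof (rule ccontr)
    assume "\<not> ?thesis"
    then have "(\<Sum>a\<in>A. d j a *\<^sub>R w a) = 0" by (intro sum.neutral) auto
    then show False using d(2)[OF that] w(2)[of j] that by simp
  qed
  then obtain f where f: "\<And>j. j \<in> I - A \<Longrightarrow> f j \<in> A" "\<And>j. j \<in> I - A \<Longrightarrow> d j (f j) \<noteq> 0"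
    by metis
  have "inj_on f (I - A)"
  proof (rule inj_onI, rule ccontr)
    fix j k assume jk: "j \<in> I - A" "k \<in> I - A" "f j = f k" "j \<noteq> k"
    let ?v = "\<lambda>j. w j + (\<Sum>a\<in>A. d j a *\<^sub>R w a)"
    define b where "b i = (if i = j then 1 else if i = k then - 1 else d j i - d k i)" for i
    have b: "b j = 1" "b k = - 1" "\<And>a. a \<in> A \<Longrightarrow> b a = d j a - d k a"
      using jk by (auto simp: b_def)
    have "?v j - ?v k = (\<Sum>i\<in>insert j (insert k A). b i *\<^sub>R w i)"
      using jk finA b by (simp add: scaleR_diff_left sum_subtractf)
    moreover have "?v j - ?v k \<in> Y"
      using d(2) jk by (intro real_vector.subspace_diff[OF sub])
    ultimately have "pprt (\<Sum>i\<in>insert j (insert k A). b i *\<^sub>R w i) \<in> Y"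
      by (simp only: pprt)
    moreover have "insert j (insert k A) \<subseteq> I" using A(1) jk by auto
    ultimately have "(\<Sum>i\<in>insert j (insert k A). max (b i) 0 *\<^sub>R w i) \<in> Y"
      by (simp only: pprt_sum)
    then have "w j + (\<Sum>a\<in>A. max (d j a - d k a) 0 *\<^sub>R w a) \<in> Y"
      using jk finA b by simp
    \<comment> \<open>Subtracting the positive part of \<open>v j - v k\<close> from \<open>v j\<close> leaves \<open>inf (v j) (v k)\<close>.\<close>
    from real_vector.subspace_diff[OF sub d(2)[OF jk(1)] this]
    have "(\<Sum>a\<in>A. (d j a - max (d j a - d k a) 0) *\<^sub>R w a) \<in> Y"
      by (simp add: scaleR_diff_left sum_subtractf)
    from indD[OF this f(1)[OF jk(1)]]
    have "min (d j (f j)) (d k (f k)) = 0"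
      using jk(3) by (simp add: min_def max_def split: if_splits)
    moreover have "d j (f j) > 0" "d k (f k) > 0"
      using f d(1) jk by (metis less_le)+
    ultimately show False by simp
  qed
  then have "card (I - A) \<le> card A"
    using f(1) by (intro card_inj_on_le[OF _ _ finA]) auto
  moreover have "card A \<le> n"
    by (rule card_le_codimension[OF sub codim finA, of w]) (use indD in blast)
  moreover have "card I = card A + card (I - A)"
    using A(1) I by (simp add: card_Diff_subset finA card_mono)
  ultimately show ?thesis by linarith
qed

text \<open>If \<open>x\<close> does not dominate two disjoint positive vectors outside \<open>J\<close>, even up to a multiple, then
  modulo \<open>J\<close> it is an atom: its principal ideal is one-dimensional. Any \<open>y\<close> below \<open>x\<close> is
  congruent to \<open>\<lambda> x\<close>, where \<open>\<lambda>\<close> is the least \<open>t\<close> with \<open>y \<le> t x\<close> modulo \<open>J\<close>.\<close>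

lemma atom_modulo_ideal:
  fixes J :: "'a::vector_lattice set"
  assumes J: "order_ideal J" "uniformly_closed J" and x: "0 \<le> x" "x \<notin> J"
    and atom: "\<And>u v C. 0 \<le> u \<Longrightarrow> 0 \<le> v \<Longrightarrow> inf u v = 0 \<Longrightarrow> 0 \<le> C \<Longrightarrow>
      u \<le> C *\<^sub>R x \<Longrightarrow> v \<le> C *\<^sub>R x \<Longrightarrow> u \<in> J \<or> v \<in> J"
    and y: "\<bar>y\<bar> \<le> x"
  shows "\<exists>l. y - l *\<^sub>R x \<in> J"
proof -
  have sub: "real_vector.subspace J" using J(1) by (rule order_ideal_subspace)
  define T where "T = {t. pprt (y - t *\<^sub>R x) \<in> J}"
  \<comment> \<open>The positive and negative parts of \<open>y - t x\<close> are disjoint and below a multiple of \<open>x\<close>.\<close>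
  have alt: "pprt (- (y - t *\<^sub>R x)) \<in> J" if "t \<notin> T" for t
  proof -
    let ?u = "y - t *\<^sub>R x"
    have "\<bar>?u\<bar> \<le> \<bar>y\<bar> + \<bar>t *\<^sub>R x\<bar>" by (rule abs_triangle_ineq4)
    also have "\<dots> \<le> x + \<bar>t\<bar> *\<^sub>R x"
      using y x by (simp add: abs_scaleR_vector_lattice abs_of_nonneg)
    also have "\<dots> = (1 + \<bar>t\<bar>) *\<^sub>R x" by (simp add: scaleR_add_left)
    finally have u: "\<bar>?u\<bar> \<le> (1 + \<bar>t\<bar>) *\<^sub>R x" .
    have "pprt ?u \<le> \<bar>?u\<bar>" "pprt (- ?u) \<le> \<bar>?u\<bar>"
      unfolding pprt_def by (simp_all add: abs_ge_self abs_ge_minus_self del: minus_diff_eq)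
    with u have "pprt ?u \<le> (1 + \<bar>t\<bar>) *\<^sub>R x" "pprt (- ?u) \<le> (1 + \<bar>t\<bar>) *\<^sub>R x"
      using order_trans by blast+
    from atom[OF zero_le_pprt zero_le_pprt inf_pprt_pprt_uminus _ this]
    show ?thesis using that by (auto simp: T_def)
  qed
  have "1 \<in> T"
  proof -
    have "y \<le> x" using y by (simp add: abs_le_iff_lattice)
    then show ?thesis using real_vector.subspace_0[OF sub] by (simp add: T_def)
  qed
  have "bdd_below T"
  proof (rule bdd_belowI[of _ "-1"], rule ccontr)
    fix t assume t: "t \<in> T" "\<not> - 1 \<le> t"
    have "- x \<le> y" using y by (metis abs_le_iff_lattice minus_le_iff)
    then have "(- 1 - t) *\<^sub>R x \<le> y - t *\<^sub>R x" by (simp add: scaleR_diff_left)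
    also have "\<dots> \<le> pprt (y - t *\<^sub>R x)" by (simp add: pprt_def)
    finally have le: "(- 1 - t) *\<^sub>R x \<le> pprt (y - t *\<^sub>R x)" .
    have "pprt (y - t *\<^sub>R x) \<in> J" using t(1) by (simp add: T_def)
    then have "(- 1 - t) *\<^sub>R x \<in> J"
      by (rule order_ideal_mono_nonneg[OF J(1) _ _ le]) (use t(2) x(1) in \<open>simp add: scaleR_nonneg_nonneg\<close>)
    from real_vector.subspace_scale[OF sub this, of "1 / (- 1 - t)"]
    show False using t x(2) by simp
  qed
  define l where "l = Inf T"
  have near: "\<bar>(y - t *\<^sub>R x) - (y - l *\<^sub>R x)\<bar> \<le> \<epsilon> *\<^sub>R x" if "\<bar>t - l\<bar> \<le> \<epsilon>" for t \<epsilon>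
  proof -
    have "\<bar>(y - t *\<^sub>R x) - (y - l *\<^sub>R x)\<bar> = \<bar>(l - t) *\<^sub>R x\<bar>"
      by (simp add: scaleR_diff_left)
    also have "\<dots> = \<bar>t - l\<bar> *\<^sub>R x"
      using x by (simp add: abs_scaleR_vector_lattice abs_of_nonneg abs_minus_commute)
    also have "\<dots> \<le> \<epsilon> *\<^sub>R x" using that x(1) by (rule scaleR_right_mono)
    finally show ?thesis .
  qed
  have "pprt (y - l *\<^sub>R x) \<in> J"
  proof (rule uniformly_closedD_approx[OF J(2) x(1)])
    fix \<epsilon> :: real assume "\<epsilon> > 0"
    then obtain t where t: "t \<in> T" "t < l + \<epsilon>"
      using cInf_lessD[of T "l + \<epsilon>"] \<open>1 \<in> T\<close> by (auto simp: l_def)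
    have "l \<le> t" unfolding l_def using t(1) \<open>bdd_below T\<close> by (rule cInf_lower)
    then have "\<bar>pprt (y - t *\<^sub>R x) - pprt (y - l *\<^sub>R x)\<bar> \<le> \<epsilon> *\<^sub>R x"
      using t(2) by (intro order_trans[OF abs_pprt_diff_le near]) auto
    then show "\<exists>a\<in>J. \<bar>a - pprt (y - l *\<^sub>R x)\<bar> \<le> \<epsilon> *\<^sub>R x"
      using t(1) by (auto simp: T_def)
  qed
  moreover have "pprt (- (y - l *\<^sub>R x)) \<in> J"
  proof (rule uniformly_closedD_approx[OF J(2) x(1)])
    fix \<epsilon> :: real assume "\<epsilon> > 0"
    let ?t = "l - \<epsilon>"
    have "?t \<notin> T"
    proof
      assume "?t \<in> T"
      then have "l \<le> ?t" unfolding l_def using \<open>bdd_below T\<close> by (rule cInf_lower)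
      then show False using \<open>\<epsilon> > 0\<close> by simp
    qed
    then have "pprt (- (y - ?t *\<^sub>R x)) \<in> J" by (rule alt)
    moreover have "\<bar>pprt (- (y - ?t *\<^sub>R x)) - pprt (- (y - l *\<^sub>R x))\<bar> \<le> \<epsilon> *\<^sub>R x"
    proof (rule order_trans[OF abs_pprt_diff_le])
      have "\<bar>- (y - ?t *\<^sub>R x) - - (y - l *\<^sub>R x)\<bar> = \<bar>(y - ?t *\<^sub>R x) - (y - l *\<^sub>R x)\<bar>"
        by (subst abs_minus_commute) simp
      also have "\<dots> \<le> \<epsilon> *\<^sub>R x" using \<open>\<epsilon> > 0\<close> by (intro near) simp
      finally show "\<bar>- (y - ?t *\<^sub>R x) - - (y - l *\<^sub>R x)\<bar> \<le> \<epsilon> *\<^sub>R x" .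
    qed
    ultimately show "\<exists>a\<in>J. \<bar>a - pprt (- (y - l *\<^sub>R x))\<bar> \<le> \<epsilon> *\<^sub>R x" by blast
  qed
  ultimately have "pprt (y - l *\<^sub>R x) - pprt (- (y - l *\<^sub>R x)) \<in> J"
    by (rule real_vector.subspace_diff[OF sub])
  then show ?thesis unfolding pprt_minus_pprt_uminus by blast
qed

text \<open>The quotient by a uniformly closed ideal is Archimedean: were all these positive parts in
  \<open>J\<close>, then \<open>t x \<le> y\<close> modulo \<open>J\<close> for every \<open>t > 0\<close>, and \<open>x\<close> would be a uniform limit, with
  regulator \<open>y\<close>, of the elements \<open>pprt (x - \<epsilon> *\<^sub>R y)\<close> of \<open>J\<close>.\<close>

lemma archimedean_modulo_ideal:
  fixes J :: "'a::vector_lattice set"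
  assumes J: "order_ideal J" "uniformly_closed J" and x: "0 \<le> x" "x \<notin> J" and y: "0 \<le> y"
  shows "\<exists>t>0. pprt (t *\<^sub>R x - y) \<notin> J"
proof (rule ccontr)
  assume "\<not> ?thesis"
  then have all: "pprt (t *\<^sub>R x - y) \<in> J" if "t > 0" for t using that by blast
  have "x \<in> J"
  proof (rule uniformly_closedD_approx[OF J(2) y])
    fix \<epsilon> :: real assume \<epsilon>: "\<epsilon> > 0"
    have "x - \<epsilon> *\<^sub>R y = \<epsilon> *\<^sub>R ((1 / \<epsilon>) *\<^sub>R x - y)"
      using \<epsilon> by (simp add: scaleR_diff_right)
    also have "\<dots> \<le> \<epsilon> *\<^sub>R pprt ((1 / \<epsilon>) *\<^sub>R x - y)"
      using \<epsilon> by (intro scaleR_left_mono) (auto simp: pprt_def)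
    finally have "pprt (x - \<epsilon> *\<^sub>R y) \<le> \<epsilon> *\<^sub>R pprt ((1 / \<epsilon>) *\<^sub>R x - y)"
      using \<epsilon> by (simp add: pprt_def[of "x - \<epsilon> *\<^sub>R y"] scaleR_nonneg_nonneg)
    then have "pprt (x - \<epsilon> *\<^sub>R y) \<in> J"
      using all[of "1 / \<epsilon>"] \<epsilon> real_vector.subspace_scale[OF order_ideal_subspace[OF J(1)]]
      by (intro order_ideal_mono_nonneg[OF J(1) _ zero_le_pprt]) auto
    moreover have "\<bar>pprt (x - \<epsilon> *\<^sub>R y) - x\<bar> \<le> \<epsilon> *\<^sub>R y"
      using abs_pprt_diff_le[of "x - \<epsilon> *\<^sub>R y" x] x(1) y \<epsilon>
      by (simp add: abs_scaleR_vector_lattice abs_of_nonneg)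
    ultimately show "\<exists>a\<in>J. \<bar>a - x\<bar> \<le> \<epsilon> *\<^sub>R y" by blast
  qed
  with x(2) show False ..
qed

text \<open>The first \<open>N\<close> terms of the sequence \<open>x\<close> are positive, pairwise disjoint and not in \<open>J\<close>; the
  other terms are irrelevant.\<close>

definition disjoint_outside :: "'a::vector_lattice set \<Rightarrow> nat \<Rightarrow> (nat \<Rightarrow> 'a) \<Rightarrow> bool" where
  "disjoint_outside J N x \<longleftrightarrow> (\<forall>i<N. 0 \<le> x i \<and> x i \<notin> J) \<and>
     (\<forall>i<N. \<forall>j<N. i \<noteq> j \<longrightarrow> inf (x i) (x j) = 0)"

lemma disjoint_outside_extend:
  assumes "disjoint_outside J N x" "0 \<le> z" "z \<notin> J" "\<And>i. i < N \<Longrightarrow> inf (x i) z = 0"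
  shows "disjoint_outside J (Suc N) (x(N := z))"
  using assms by (auto simp: disjoint_outside_def less_Suc_eq inf_commute)

text \<open>The sum \<open>V\<close> of \<open>J\<close> and the span of a maximal family is the whole space. The solid core of
  \<open>V\<close> is an ideal that contains \<open>J\<close> and, as they are atoms modulo \<open>J\<close>, also the \<open>x i\<close>. So a
  positive \<open>y\<close> is in \<open>V\<close> once it is dominated by a combination of the \<open>x i\<close> modulo \<open>J\<close>. To see
  that it is, replace every \<open>x i\<close> by \<open>pprt (t i *\<^sub>R x i - y)\<close>, with \<open>t i\<close> so large that this is not
  in \<open>J\<close>. The new family is disjoint from \<open>pprt (y - (\<Sum>i<N. t i *\<^sub>R x i))\<close>, which must therefore be
  in \<open>J\<close> by maximality.\<close>

lemma span_of_maximal_disjoint_family: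
  fixes J :: "'a::vector_lattice set"
  assumes J: "order_ideal J" "uniformly_closed J" and x: "disjoint_outside J N x"
    and maximal: "\<And>x. \<not> disjoint_outside J (Suc N) x"
  shows "\<exists>c. y - (\<Sum>i<N. c i *\<^sub>R x i) \<in> J"
proof -
  have sub: "real_vector.subspace J" using J(1) by (rule order_ideal_subspace)
  have xi: "0 \<le> x i" "x i \<notin> J" if "i < N" for i
    using x that by (auto simp: disjoint_outside_def)
  have xd: "inf (x i) (x j) = 0" if "i < N" "j < N" "i \<noteq> j" for i j
    using x that by (auto simp: disjoint_outside_def)
  define V where "V = {y. \<exists>c. y - (\<Sum>i<N. c i *\<^sub>R x i) \<in> J}"
  have V: "real_vector.subspace V"
  proof (rule real_vector.subspaceI)
    show "0 \<in> V"
      using real_vector.subspace_0[OF sub] by (auto simp: V_def intro!: exI[of _ "\<lambda>_. 0"])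
  next
    fix a b assume "a \<in> V" "b \<in> V"
    then obtain c d where "a - (\<Sum>i<N. c i *\<^sub>R x i) \<in> J" "b - (\<Sum>i<N. d i *\<^sub>R x i) \<in> J"
      by (auto simp: V_def)
    from real_vector.subspace_add[OF sub this]
    have "(a + b) - (\<Sum>i<N. (c i + d i) *\<^sub>R x i) \<in> J"
      by (simp add: scaleR_add_left sum.distrib algebra_simps)
    then show "a + b \<in> V" by (auto simp: V_def)
  next
    fix r a assume "a \<in> V"
    then obtain c where "a - (\<Sum>i<N. c i *\<^sub>R x i) \<in> J" by (auto simp: V_def)
    from real_vector.subspace_scale[OF sub this, of r]
    have "r *\<^sub>R a - (\<Sum>i<N. (r * c i) *\<^sub>R x i) \<in> J"
      by (simp add: scaleR_diff_right scaleR_sum_right)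
    then show "r *\<^sub>R a \<in> V" by (auto simp: V_def)
  qed
  have core: "order_ideal (solid_core V)" using V by (rule order_ideal_solid_core)
  have "J \<subseteq> V" by (auto simp: V_def intro!: exI[of _ "\<lambda>_. 0"])
  with J(1) have J_core: "J \<subseteq> solid_core V" by (rule order_ideal_subset_solid_core)
  have x_core: "x i \<in> solid_core V" if i: "i < N" for i
    unfolding solid_core_def
  proof clarify
    fix y assume "\<bar>y\<bar> \<le> \<bar>x i\<bar>"
    then have y: "\<bar>y\<bar> \<le> x i" using xi(1)[OF i] by (simp add: abs_of_nonneg)
    have "\<exists>l. y - l *\<^sub>R x i \<in> J"
    proof (rule atom_modulo_ideal[OF J xi[OF i] _ y])
      fix u v C
      assume uv: "0 \<le> u" "0 \<le> v" "inf u v = 0" "0 \<le> C" "u \<le> C *\<^sub>R x i" "v \<le> C *\<^sub>R x i"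
      show "u \<in> J \<or> v \<in> J"
      proof (rule ccontr)
        assume notin: "\<not> (u \<in> J \<or> v \<in> J)"
        have below: "inf s (x j) = 0" if "0 \<le> s" "s \<le> C *\<^sub>R x i" "j < N" "j \<noteq> i" for s j
          by (rule disjoint_mono[OF disjoint_scaleR[OF xd[OF i that(3)] uv(4)]])
            (use that xi in auto)
        \<comment> \<open>Splitting \<open>x i\<close> into \<open>u\<close> and \<open>v\<close> would give a larger family.\<close>
        have "disjoint_outside J N (x(i := u))"
          using x uv(1,5) notin below[of u] by (auto simp: disjoint_outside_def inf_commute)
        then have "disjoint_outside J (Suc N) ((x(i := u))(N := v))"
          by (rule disjoint_outside_extend)
            (use uv notin below[of v] in \<open>auto simp: inf_commute\<close>)
        with maximal show False by blast
      qed
    qed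
    then obtain l where l: "y - l *\<^sub>R x i \<in> J" by blast
    have "(\<Sum>k<N. (if k = i then l else 0) *\<^sub>R x k) = l *\<^sub>R x i"
      using i by (simp add: if_distrib[of "\<lambda>r. r *\<^sub>R _"] cong: if_cong)
    with l show "y \<in> V"
      unfolding V_def by (auto intro!: exI[of _ "\<lambda>k. if k = i then l else 0"])
  qed
  have nonneg: "y \<in> V" if y: "0 \<le> y" for y
  proof -
    have "\<forall>i. \<exists>t. i < N \<longrightarrow> t > 0 \<and> pprt (t *\<^sub>R x i - y) \<notin> J"
      using archimedean_modulo_ideal[OF J xi y] by blast
    then obtain t where t: "\<And>i. i < N \<Longrightarrow> t i > 0" "\<And>i. i < N \<Longrightarrow> pprt (t i *\<^sub>R x i - y) \<notin> J"
      by metis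
    define s where "s = (\<Sum>i<N. t i *\<^sub>R x i)"
    define u where "u i = pprt (t i *\<^sub>R x i - y)" for i
    have tx: "0 \<le> t i *\<^sub>R x i" if "i < N" for i
      using t(1) xi(1) that by (simp add: scaleR_nonneg_nonneg less_imp_le)
    have ule: "u i \<le> t i *\<^sub>R x i" if "i < N" for i
      using tx[OF that] y by (simp add: u_def pprt_def diff_le_eq)
    have u_disj: "inf (u i) (u j) = 0" if ij: "i < N" "j < N" "i \<noteq> j" for i j
    proof (rule disjoint_mono)
      have "inf (x j) (t i *\<^sub>R x i) = 0"
        using disjoint_scaleR[OF xd[OF ij], of "t i"] t(1)[OF ij(1)] by (simp add: inf_commute)
      then show "inf (t i *\<^sub>R x i) (t j *\<^sub>R x j) = 0"
        using disjoint_scaleR[of "x j" "t i *\<^sub>R x i" "t j"] t(1)[OF ij(2)] by (simp add: inf_commute)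
    qed (use ule ij in \<open>auto simp: u_def\<close>)
    have u: "disjoint_outside J N u"
      using t(2) u_disj by (auto simp: disjoint_outside_def u_def)
    have "pprt (y - s) \<in> J"
    proof (rule ccontr)
      assume z: "pprt (y - s) \<notin> J"
      have "inf (u i) (pprt (y - s)) = 0" if i: "i < N" for i
      proof (rule disjoint_mono[OF inf_pprt_pprt_uminus])
        have "t i *\<^sub>R x i \<le> s"
          unfolding s_def using sum_mono2[of "{..<N}" "{i}" "\<lambda>i. t i *\<^sub>R x i"] i tx by auto
        then show "pprt (y - s) \<le> pprt (- (t i *\<^sub>R x i - y))" by (intro pprt_mono) simp
      qed (auto simp: u_def)
      then have "disjoint_outside J (Suc N) (u(N := pprt (y - s)))"
        using z by (intro disjoint_outside_extend[OF u]) auto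
      with maximal show False by blast
    qed
    then have "pprt (y - s) \<in> solid_core V" using J_core by blast
    moreover have "s \<in> solid_core V"
      unfolding s_def
      by (intro real_vector.subspace_sum real_vector.subspace_scale order_ideal_subspace core x_core)
        simp
    ultimately have "pprt (y - s) + s \<in> solid_core V"
      by (intro real_vector.subspace_add order_ideal_subspace core)
    moreover have "y \<le> pprt (y - s) + s"
      by (simp add: pprt_def diff_le_eq[symmetric])
    ultimately show "y \<in> V"
      using order_ideal_mono_nonneg[OF core _ y] solid_core_subset by blast
  qed
  have "pprt y - pprt (- y) \<in> V"
    by (intro real_vector.subspace_diff[OF V] nonneg zero_le_pprt)
  then show ?thesis unfolding pprt_minus_pprt_uminus by (simp add: V_def)
qed


section \<open>Ideals in sublattices of finite codimension\<close>

lemma disjoint_outside_solid_core_bound: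
  fixes Y :: "'a::vector_lattice set"
  assumes Y: "sublattice Y" and codim: "has_codimension Y n"
    and x: "disjoint_outside (solid_core Y) N x"
  shows "N \<le> 2 * n"
proof -
  have sub: "real_vector.subspace Y" using Y by (simp add: sublattice_def)
  have "\<exists>w. 0 \<le> w \<and> w \<le> x i \<and> w \<notin> Y" if "i < N" for i
  proof -
    have "0 \<le> x i" "x i \<notin> solid_core Y" using x that by (auto simp: disjoint_outside_def)
    then obtain y where y: "\<bar>y\<bar> \<le> x i" "y \<notin> Y"
      by (auto simp: solid_core_def abs_of_nonneg)
    have "pprt y \<notin> Y \<or> pprt (- y) \<notin> Y"
      using real_vector.subspace_diff[OF sub, of "pprt y" "pprt (- y)"] y(2)
      by (auto simp: pprt_minus_pprt_uminus)
    moreover have "pprt y \<le> x i" "pprt (- y) \<le> x i"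
      using y(1) \<open>0 \<le> x i\<close> by (simp_all add: pprt_def abs_le_iff_lattice)
    ultimately show ?thesis using zero_le_pprt by blast
  qed
  then obtain w where w: "\<And>i. i < N \<Longrightarrow> 0 \<le> w i \<and> w i \<le> x i \<and> w i \<notin> Y" by metis
  have "card {..<N} \<le> 2 * n"
  proof (rule card_disjoint_family_le[OF Y codim, of _ w])
    show "inf (w i) (w j) = 0" if "i \<in> {..<N}" "j \<in> {..<N}" "i \<noteq> j" for i j
      by (rule disjoint_mono[of "x i" "x j"])
        (use that w x in \<open>auto simp: disjoint_outside_def\<close>)
  qed (use w in auto)
  then show ?thesis by simp
qed

theorem proposition5p12:
  fixes Y :: "'a::archimedean_vector_lattice set" and n :: nat
  assumes "sublattice Y" and "uniformly_closed Y" and "has_codimension Y n"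
  shows "\<exists>J. order_ideal J \<and> uniformly_closed J \<and> J \<subseteq> Y \<and> (\<exists>m\<le>2 * n. has_codimension J m)"
proof -
  let ?J = "solid_core Y"
  have sub: "real_vector.subspace Y" using assms(1) by (simp add: sublattice_def)
  have J: "order_ideal ?J" "uniformly_closed ?J"
    by (rule order_ideal_solid_core[OF sub], rule uniformly_closed_solid_core[OF assms(2)])
  let ?P = "\<lambda>N. \<exists>x. disjoint_outside ?J N x"
  have bound: "N \<le> 2 * n" if "?P N" for N
    using that disjoint_outside_solid_core_bound[OF assms(1,3)] by blast
  have "?P 0" by (simp add: disjoint_outside_def)
  then have "?P (Greatest ?P)" by (rule GreatestI_nat) (rule bound)
  then obtain N x where N: "N = Greatest ?P" and x: "disjoint_outside ?J N x" by blast
  have maximal: "\<not> disjoint_outside ?J (Suc N) x" for x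
    using Greatest_le_nat[of ?P "Suc N" "2 * n"] bound unfolding N by fastforce
  have "\<exists>m\<le>card {..<N}. has_codimension ?J m"
    by (rule codimension_le_card[OF order_ideal_subspace[OF J(1)], where x = x])
      (use span_of_maximal_disjoint_family[OF J x maximal] in auto)
  then obtain m where "m \<le> N" "has_codimension ?J m" by auto
  moreover have "N \<le> 2 * n" by (rule bound) (use x in blast)
  ultimately have "\<exists>m\<le>2 * n. has_codimension ?J m" by (blast intro: order_trans)
  then show ?thesis using J solid_core_subset[of Y] by blast
qed

end
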